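(* If $\vdash G\triangleright N$, $G$ is bounded and $G\parallel\mathcal M$ is balanced, then the session $N\parallel\mathcal M$ is queue-consuming.
   Context: Participants $\mathsf p,\mathsf q,\mathsf r,\mathsf s$; labels $\lambda$. Processes are the possibly infinite but regular terms coinductively generated by $P ::= \mathbf 0 \mid \mathsf p!\{\lambda_i;P_i\}_{i\in I}\mid \mathsf p?\{\lambda_i;P_i\}_{i\in I}$, $I$ finite nonempty, $\lambda_i$ pairwise distinct. A network is $N=\mathsf p_1[\![P_1]\!]\parallel\cdots\parallel\mathsf p_n[\![P_n]\!]$ with $n>0$ and pairwise distinct $\mathsf p_i$, taken modulo permutation and adding/removing components $\mathsf p[\![\mathbf 0]\!]$; $\mathrm{plays}(N)$ is the set of $\mathsf p$ with $N\equiv\mathsf p[\![P]\!]\parallel N'$, $P\neq\mathbf 0$. A message is $\langle\mathsf p,\lambda,\mathsf q\rangle$; a queue $\mathcal M$ is a finite sequence of messages ($\emptyset$, $\cdot$), modulo the congruence $\equiv$ generated by $\langle\mathsf p,\lambda,\mathsf q\rangle\cdot\langle\mathsf r,\lambda',\mathsf s\rangle\equiv\langle\mathsf r,\lambda',\mathsf s\rangle\cdot\langle\mathsf p,\lambda,\mathsf q\rangle$ when $\mathsf p\neq\mathsf r$ or $\mathsf q\neq\mathsf s$. Communications $\beta::=\mathsf p\mathsf q!\lambda\mid\mathsf p\mathsf q?\lambda$, $\mathrm{play}(\mathsf p\mathsf q!\lambda)=\mathsf p$, $\mathrm{play}(\mathsf p\mathsf q?\lambda)=\mathsf q$. Sessions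 $N\parallel\mathcal M$ reduce by: $\mathsf p[\![\mathsf q!\{\lambda_i;P_i\}_{i\in I}]\!]\parallel N\parallel\mathcal M\xrightarrow{\mathsf p\mathsf q!\lambda_h}\mathsf p[\![P_h]\!]\parallel N\parallel\mathcal M\cdot\langle\mathsf p,\lambda_h,\mathsf q\rangle$ and $\mathsf q[\![\mathsf p?\{\lambda_i;Q_i\}_{i\in I}]\!]\parallel N\parallel\langle\mathsf p,\lambda_h,\mathsf q\rangle\cdot\mathcal M\xrightarrow{\mathsf p\mathsf q?\lambda_h}\mathsf q[\![Q_h]\!]\parallel N\parallel\mathcal M$, $h\in I$. Lockstep: a nonempty set $\Delta$ of communications is coherent for a session $S$ if distinct elements of $\Delta$ have distinct players and $S$ has a $\beta$-transition for each $\beta\in\Delta$; $S\Rightarrow_\Delta S'$ if $\Delta=\{\beta_1,\ldots,\beta_n\}$ is a maximal coherent set for $S$ and $S\xrightarrow{\beta_1}\cdots\xrightarrow{\beta_n}S'$. A complete lockstep computation from $S$ is a sequence $S=S_0\Rightarrow_{\Delta_0}S_1\Rightarrow_{\Delta_1}\cdots$ which is infinite or finite with a last session having no transition. $N\parallel\mathcal M$ is queue-consuming if whenever $\mathcal M\equiv\langle\mathsf p,\lambda,\mathsf q\rangle\cdot\mathcal M'$, every complete lockstep computation from $N\parallel\mathcal M$ has a step $h$ with $\mathsf p\mathsf q?\lambda\in\Delta_h$. Global types: possibly infinite regular terms $G ::= \mathsf{End}\mid \mathsf p\mathsf q!\{\lambda_i;G_i\}_{i\in I}\mid\mathsf p\mathsf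 q?\{\lambda_i;G_i\}_{i\in I}$ ($I$ finite nonempty, $\mathsf p\neq\mathsf q$, $\lambda_i$ distinct); $\mathsf p\mathsf q\dagger$ denotes either form. $\mathrm{play}(\mathsf p\mathsf q!\{\ldots\})=\mathsf p$, $\mathrm{play}(\mathsf p\mathsf q?\{\ldots\})=\mathsf q$; $\mathrm{plays}(G)$ least set with $\mathrm{plays}(\mathsf{End})=\emptyset$, $\mathrm{plays}(G)=\{\mathrm{play}(G)\}\cup\bigcup_i\mathrm{plays}(G_i)$. Typing $\vdash G\triangleright N$ (coinductive): (End) $\vdash\mathsf{End}\triangleright\mathsf p[\![\mathbf 0]\!]$; (Out) if $\forall i\in I$: $\vdash G_i\triangleright\mathsf p[\![P_i]\!]\parallel N$ and $\mathrm{plays}(G_i)\setminus\{\mathsf p\}=\mathrm{plays}(N)$, then $\vdash\mathsf p\mathsf q!\{\lambda_i;G_i\}_{i\in I}\triangleright\mathsf p[\![\mathsf q!\{\lambda_i;P_i\}_{i\in I}]\!]\parallel N$; (In) if $I\subseteq J$ and $\forall i\in I$: $\vdash G_i\triangleright\mathsf p[\![P_i]\!]\parallel N$ and $\mathrm{plays}(G_i)\setminus\{\mathsf p\}=\mathrm{plays}(N)$, then $\vdash\mathsf q\mathsf p?\{\lambda_i;G_i\}_{i\in I}\triangleright\mathsf p[\![\mathsf q?\{\lambda_j;P_j\}_{j\in J}]\!]\parallel N$. Boundedness: $\mathrm{Paths}(G)$ is the greatest family with $\mathrm{Paths}(\mathsf{End})=\{\epsilon\}$ and $\mathrm{Paths}(\mathsf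 p\mathsf q\dagger\{\lambda_i;G_i\}_{i\in I})=\bigcup_{i}\{\mathsf p\mathsf q\dagger\lambda_i\cdot\xi\mid\xi\in\mathrm{Paths}(G_i)\}$; $\mathrm{depth}(\xi,\mathsf p)=\inf\{n\mid\mathrm{play}(\xi_n)=\mathsf p\}$ ($\inf\emptyset=\infty$); $\mathrm{depth}(G,\mathsf p)=1+\sup\{\mathrm{depth}(\xi,\mathsf p)\mid\xi\in\mathrm{Paths}(G)\}$ if $\mathsf p\in\mathrm{plays}(G)$, else $0$. $G$ is bounded if $\mathrm{depth}(G',\mathsf p)<\infty$ for all $G'$ occurring in $G$ and all $\mathsf p\in\mathrm{plays}(G')$. Readability $\mathrm{read}(G,\mathcal M)$ (inductive): $\mathrm{read}(G,\emptyset)$; $\mathrm{read}(\mathsf p\mathsf q!\{\lambda_i;G_i\}_{i\in I},\mathcal M)$ if $\mathrm{read}(G_i,\mathcal M)$ $\forall i\in I$; $\mathrm{read}(\mathsf p\mathsf q?\{\lambda_i;G_i\}_{i\in I},\langle\mathsf p,\lambda_h,\mathsf q\rangle\cdot\mathcal M)$ if $h\in I$ and $\mathrm{read}(G_i,\mathcal M)$ $\forall i\in I$; $\mathrm{read}(\mathsf p\mathsf q?\{\lambda_i;G_i\}_{i\in I},\mathcal M)$ if $\mathcal M\not\equiv\langle\mathsf p,\lambda_i,\mathsf q\rangle\cdot\mathcal M'$ for all $i\in I$, $\mathcal M'$, and $\mathrm{read}(G_i,\mathcal M)$ $\forall i\in I$. Balancing (coinductive): $\mathsf{End}\parallel\emptyset$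 is balanced; $G=\mathsf p\mathsf q!\{\lambda_i;G_i\}_{i\in I}$ with $\mathcal M$ is balanced if $\mathrm{read}(G,\mathcal M)$ and each $G_i\parallel\mathcal M\cdot\langle\mathsf p,\lambda_i,\mathsf q\rangle$ is balanced; $G=\mathsf p\mathsf q?\{\lambda_i;G_i\}_{i\in I}$ with $\langle\mathsf p,\lambda_h,\mathsf q\rangle\cdot\mathcal M$, $h\in I$, is balanced if $\mathrm{read}(G,\langle\mathsf p,\lambda_h,\mathsf q\rangle\cdot\mathcal M)$ and $G_h\parallel\mathcal M$ is balanced. *)

theory Defs
  imports "HOL-Library.Finite_Map" "HOL-Library.Extended_Nat"
begin

section \<open>Processes\<close>

text \<open>
  A choice \<open>{\<lambda>\<^sub>i; P\<^sub>i}\<^sub>i\<^sub>\<in>\<^sub>I\<close> is a finite map from labels to continuations, so that \<open>I\<close> is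
  finite and the labels are pairwise distinct by construction.  Non-emptiness of \<open>I\<close> and
  regularity of the term are imposed separately by \<open>wf_proc\<close>.
\<close>

codatatype ('p, 'l) proc =
    Inact
  | Send 'p "('l, ('p, 'l) proc) fmap"
  | Recv 'p "('l, ('p, 'l) proc) fmap"

inductive_set subprocs :: "('p, 'l) proc \<Rightarrow> ('p, 'l) proc set" for P where
  self: "P \<in> subprocs P"
| send: "\<lbrakk>Send q Ps \<in> subprocs P; fmlookup Ps l = Some Q\<rbrakk> \<Longrightarrow> Q \<in> subprocs P"
| recv: "\<lbrakk>Recv q Ps \<in> subprocs P; fmlookup Ps l = Some Q\<rbrakk> \<Longrightarrow> Q \<in> subprocs P"

definition wf_proc :: "('p, 'l) proc \<Rightarrow> bool" where
  "wf_proc P \<longleftrightarrow>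
     finite (subprocs P) \<and>
     (\<forall>q Ps. Send q Ps \<in> subprocs P \<or> Recv q Ps \<in> subprocs P \<longrightarrow> Ps \<noteq> fmempty)"

section \<open>Networks\<close>

text \<open>
  Networks modulo permutation of components and addition or removal of inactive components
  \<open>p[[0]]\<close> are exactly the finitely supported functions from participants to processes.
  If \<open>N p = Inact\<close>, then \<open>N(p := P)\<close> is the parallel composition of \<open>p[[P]]\<close> and \<open>N\<close>.
\<close>

type_synonym ('p, 'l) network = "'p \<Rightarrow> ('p, 'l) proc"

definition nplays :: "('p, 'l) network \<Rightarrow> 'p set" where
  "nplays N = {p. N p \<noteq> Inact}"

definition wf_network :: "('p, 'l) network \<Rightarrow> bool" where
  "wf_network N \<longleftrightarrow> finite (nplays N) \<and> (\<forall>p. wf_proc (N p))"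

section \<open>Queues\<close>

text \<open>The message \<open>(p, l, q)\<close> is sent by \<open>p\<close> to \<open>q\<close> with label \<open>l\<close>.\<close>

type_synonym ('p, 'l) message = "'p \<times> 'l \<times> 'p"

inductive qcong :: "('p, 'l) message list \<Rightarrow> ('p, 'l) message list \<Rightarrow> bool" where
  swap: "p \<noteq> r \<or> q \<noteq> s \<Longrightarrow>
    qcong (M1 @ [(p, l, q), (r, l', s)] @ M2) (M1 @ [(r, l', s), (p, l, q)] @ M2)"
| refl: "qcong M M"
| sym: "qcong M M' \<Longrightarrow> qcong M' M"
| trans: "\<lbrakk>qcong M M'; qcong M' M''\<rbrakk> \<Longrightarrow> qcong M M''"

lemma equivp_qcong: "equivp qcong"
  by (rule equivpI) (auto simp: reflp_def symp_def transp_def intro: qcong.intros)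

lemma qcong_append_left: "qcong M M' \<Longrightarrow> qcong (K @ M) (K @ M')"
proof (induction rule: qcong.induct)
  case (swap p r q s M1 l l' M2)
  then show ?case
    using qcong.swap[of p r q s "K @ M1" l l' M2] by simp
qed (blast intro: qcong.intros)+

lemma qcong_append_right: "qcong M M' \<Longrightarrow> qcong (M @ K) (M' @ K)"
proof (induction rule: qcong.induct)
  case (swap p r q s M1 l l' M2)
  then show ?case
    using qcong.swap[of p r q s M1 l l' "M2 @ K"] by simp
qed (blast intro: qcong.intros)+

quotient_type ('p, 'l) queue = "('p, 'l) message list" / qcong
  by (rule equivp_qcong)

lift_definition qempty :: "('p, 'l) queue" is "[]" .

lift_definition qmsg :: "'p \<Rightarrow> 'l \<Rightarrow> 'p \<Rightarrow> ('p, 'l) queue" is "\<lambda>p l q. [(p, l, q)]" .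

lift_definition qapp :: "('p, 'l) queue \<Rightarrow> ('p, 'l) queue \<Rightarrow> ('p, 'l) queue" (infixr "\<cdot>" 65)
  is "(@)"
  by (blast intro: qcong.trans qcong_append_left qcong_append_right)

section \<open>Sessions and their reduction\<close>

text \<open>\<open>Out p q l\<close> and \<open>In p q l\<close> are the communications \<open>pq!l\<close> and \<open>pq?l\<close>.\<close>

datatype ('p, 'l) comm = Out 'p 'p 'l | In 'p 'p 'l

fun play :: "('p, 'l) comm \<Rightarrow> 'p" where
  "play (Out p q l) = p"
| "play (In p q l) = q"

type_synonym ('p, 'l) session = "('p, 'l) network \<times> ('p, 'l) queue"

inductive step :: "('p, 'l) session \<Rightarrow> ('p, 'l) comm \<Rightarrow> ('p, 'l) session \<Rightarrow> bool" where
  out: "\<lbrakk>N p = Send q Ps; fmlookup Ps l = Some P\<rbrakk>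
    \<Longrightarrow> step (N, M) (Out p q l) (N(p := P), M \<cdot> qmsg p l q)"
| inp: "\<lbrakk>N q = Recv p Qs; fmlookup Qs l = Some Q\<rbrakk>
    \<Longrightarrow> step (N, qmsg p l q \<cdot> M) (In p q l) (N(q := Q), M)"

inductive steps :: "('p, 'l) session \<Rightarrow> ('p, 'l) comm list \<Rightarrow> ('p, 'l) session \<Rightarrow> bool" where
  nil: "steps S [] S"
| cons: "\<lbrakk>step S b S'; steps S' bs S''\<rbrakk> \<Longrightarrow> steps S (b # bs) S''"

definition coherent :: "('p, 'l) session \<Rightarrow> ('p, 'l) comm set \<Rightarrow> bool" where
  "coherent S D \<longleftrightarrow> D \<noteq> {} \<and> inj_on play D \<and> (\<forall>b\<in>D. \<exists>S'. step S b S')"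

definition max_coherent :: "('p, 'l) session \<Rightarrow> ('p, 'l) comm set \<Rightarrow> bool" where
  "max_coherent S D \<longleftrightarrow> coherent S D \<and> (\<forall>D'. coherent S D' \<and> D \<subseteq> D' \<longrightarrow> D' = D)"

definition lockstep ::
  "('p, 'l) session \<Rightarrow> ('p, 'l) comm set \<Rightarrow> ('p, 'l) session \<Rightarrow> bool" where
  "lockstep S D S' \<longleftrightarrow>
     max_coherent S D \<and> (\<exists>bs. distinct bs \<and> set bs = D \<and> steps S bs S')"

text \<open>
  A computation with \<open>n\<close> steps, \<open>n\<close> possibly infinite, consists of the sessions \<open>Ss i\<close> for
  \<open>i \<le> n\<close> and the sets \<open>Ds i\<close> for \<open>i < n\<close>; the other values of \<open>Ss\<close> and \<open>Ds\<close> are irrelevant.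
\<close>

definition complete_lockstep ::
  "('p, 'l) session \<Rightarrow> enat \<Rightarrow> (nat \<Rightarrow> ('p, 'l) session) \<Rightarrow> (nat \<Rightarrow> ('p, 'l) comm set) \<Rightarrow> bool"
where
  "complete_lockstep S n Ss Ds \<longleftrightarrow>
     Ss 0 = S \<and>
     (\<forall>i. enat i < n \<longrightarrow> lockstep (Ss i) (Ds i) (Ss (Suc i))) \<and>
     (\<forall>k. n = enat k \<longrightarrow> (\<nexists>b S'. step (Ss k) b S'))"

definition queue_consuming :: "('p, 'l) network \<Rightarrow> ('p, 'l) queue \<Rightarrow> bool" where
  "queue_consuming N M \<longleftrightarrow>
     (\<forall>p l q M'. M = qmsg p l q \<cdot> M' \<longrightarrow>
        (\<forall>n Ss Ds. complete_lockstep (N, M) n Ss Ds \<longrightarrow>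
           (\<exists>h. enat h < n \<and> In p q l \<in> Ds h)))"

section \<open>Global types\<close>

text \<open>As for processes, the conditions \<open>I \<noteq> \<emptyset>\<close>, \<open>p \<noteq> q\<close> and regularity are in \<open>wf_gtype\<close>.\<close>

codatatype ('p, 'l) gtype =
    End
  | GOut 'p 'p "('l, ('p, 'l) gtype) fmap"
  | GIn 'p 'p "('l, ('p, 'l) gtype) fmap"

inductive_set subgtypes :: "('p, 'l) gtype \<Rightarrow> ('p, 'l) gtype set" for G where
  self: "G \<in> subgtypes G"
| out: "\<lbrakk>GOut p q Gs \<in> subgtypes G; fmlookup Gs l = Some G'\<rbrakk> \<Longrightarrow> G' \<in> subgtypes G"
| inp: "\<lbrakk>GIn p q Gs \<in> subgtypes G; fmlookup Gs l = Some G'\<rbrakk> \<Longrightarrow> G' \<in> subgtypes G"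

definition wf_gtype :: "('p, 'l) gtype \<Rightarrow> bool" where
  "wf_gtype G \<longleftrightarrow>
     finite (subgtypes G) \<and>
     (\<forall>p q Gs. GOut p q Gs \<in> subgtypes G \<or> GIn p q Gs \<in> subgtypes G \<longrightarrow>
        Gs \<noteq> fmempty \<and> p \<noteq> q)"

inductive in_gplays :: "'p \<Rightarrow> ('p, 'l) gtype \<Rightarrow> bool" where
  out_here: "in_gplays p (GOut p q Gs)"
| inp_here: "in_gplays q (GIn p q Gs)"
| out_later: "\<lbrakk>fmlookup Gs l = Some G; in_gplays r G\<rbrakk> \<Longrightarrow> in_gplays r (GOut p q Gs)"
| inp_later: "\<lbrakk>fmlookup Gs l = Some G; in_gplays r G\<rbrakk> \<Longrightarrow> in_gplays r (GIn p q Gs)"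

definition gplays :: "('p, 'l) gtype \<Rightarrow> 'p set" where
  "gplays G = {p. in_gplays p G}"

section \<open>Typing\<close>

coinductive typed :: "('p, 'l) gtype \<Rightarrow> ('p, 'l) network \<Rightarrow> bool" where
  End: "typed End (\<lambda>_. Inact)"
| Out: "\<lbrakk>N p = Inact; fmdom Gs = fmdom Ps;
    \<forall>l G P. fmlookup Gs l = Some G \<and> fmlookup Ps l = Some P \<longrightarrow>
      typed G (N(p := P)) \<and> gplays G - {p} = nplays N\<rbrakk>
    \<Longrightarrow> typed (GOut p q Gs) (N(p := Send q Ps))"
| In: "\<lbrakk>N p = Inact; fmdom Gs |\<subseteq>| fmdom Ps;
    \<forall>l G P. fmlookup Gs l = Some G \<and> fmlookup Ps l = Some P \<longrightarrow>
      typed G (N(p := P)) \<and> gplays G - {p} = nplays N\<rbrakk>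
    \<Longrightarrow> typed (GIn q p Gs) (N(p := Recv q Ps))"

section \<open>Boundedness\<close>

codatatype 'a llist = LNil | LCons 'a "'a llist"

primrec lnth_opt :: "nat \<Rightarrow> 'a llist \<Rightarrow> 'a option" where
  "lnth_opt 0 xs = (case xs of LNil \<Rightarrow> None | LCons x _ \<Rightarrow> Some x)"
| "lnth_opt (Suc n) xs = (case xs of LNil \<Rightarrow> None | LCons _ ys \<Rightarrow> lnth_opt n ys)"

coinductive is_path :: "('p, 'l) gtype \<Rightarrow> ('p, 'l) comm llist \<Rightarrow> bool" where
  End: "is_path End LNil"
| Out: "\<lbrakk>fmlookup Gs l = Some G; is_path G xi\<rbrakk> \<Longrightarrow> is_path (GOut p q Gs) (LCons (Out p q l) xi)"
| In: "\<lbrakk>fmlookup Gs l = Some G; is_path G xi\<rbrakk> \<Longrightarrow> is_path (GIn p q Gs) (LCons (In p q l) xi)"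

definition Paths :: "('p, 'l) gtype \<Rightarrow> ('p, 'l) comm llist set" where
  "Paths G = {xi. is_path G xi}"

text \<open>Paths are indexed from 0.  In \<^typ>\<open>enat\<close>, the infimum of the empty set is \<open>\<infinity>\<close>.\<close>

definition path_depth :: "('p, 'l) comm llist \<Rightarrow> 'p \<Rightarrow> enat" where
  "path_depth xi p = Inf {enat n |n. \<exists>b. lnth_opt n xi = Some b \<and> play b = p}"

definition depth :: "('p, 'l) gtype \<Rightarrow> 'p \<Rightarrow> enat" where
  "depth G p = (if p \<in> gplays G then 1 + (SUP xi\<in>Paths G. path_depth xi p) else 0)"

definition bounded_gtype :: "('p, 'l) gtype \<Rightarrow> bool" where
  "bounded_gtype G \<longleftrightarrow> (\<forall>G'\<in>subgtypes G. \<forall>p\<in>gplays G'. depth G' p < \<infinity>)"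

section \<open>Readability and balancing\<close>

inductive readable :: "('p, 'l) gtype \<Rightarrow> ('p, 'l) queue \<Rightarrow> bool" where
  empty: "readable G qempty"
| out: "(\<forall>l G. fmlookup Gs l = Some G \<longrightarrow> readable G M) \<Longrightarrow> readable (GOut p q Gs) M"
| inp_read: "\<lbrakk>h |\<in>| fmdom Gs; \<forall>l G. fmlookup Gs l = Some G \<longrightarrow> readable G M\<rbrakk>
    \<Longrightarrow> readable (GIn p q Gs) (qmsg p h q \<cdot> M)"
| inp_skip: "\<lbrakk>\<forall>l M'. l |\<in>| fmdom Gs \<longrightarrow> M \<noteq> qmsg p l q \<cdot> M';
    \<forall>l G. fmlookup Gs l = Some G \<longrightarrow> readable G M\<rbrakk>
    \<Longrightarrow> readable (GIn p q Gs) M"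

coinductive balanced :: "('p, 'l) gtype \<Rightarrow> ('p, 'l) queue \<Rightarrow> bool" where
  End: "balanced End qempty"
| Out: "\<lbrakk>readable (GOut p q Gs) M;
    \<forall>l G. fmlookup Gs l = Some G \<longrightarrow> balanced G (M \<cdot> qmsg p l q)\<rbrakk>
    \<Longrightarrow> balanced (GOut p q Gs) M"
| In: "\<lbrakk>fmlookup Gs h = Some G; readable (GIn p q Gs) (qmsg p h q \<cdot> M); balanced G M\<rbrakk>
    \<Longrightarrow> balanced (GIn p q Gs) (qmsg p h q \<cdot> M)"

end

theory Submission
  imports Defs "HOL-Library.Sublist"
begin

text \<open>
  Fix a complete lockstep computation.  Instead of reducing \<open>G\<close> along the computation, we read off
  it a path of \<open>G\<close>: at every node the player of the root eventually moves in the computation, and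
  its choice selects the branch.  The players advance along the path at different speeds, so each
  player \<open>r\<close> has its own clock \<open>t r\<close>, the number of rounds of the computation it has used up.
  An output is enabled at once, and lockstep makes every enabled player move.  An input whose message
  is at the head of the path's queue is enabled at the latest when both sender and receiver have
  reached their clocks, and it reads the same label, since queues are FIFO for each sender and
  receiver.  Readability is inductive, so the path reads the given message after finitely many
  nodes, and therefore so does the computation.
\<close>

section \<open>Queues as families of channels\<close>

text \<open>The congruence never swaps two messages with the same sender and receiver, so these
  label sequences are invariants of the queue.\<close>

lift_definition channel :: "'p \<Rightarrow> 'p \<Rightarrow> ('p, 'l) queue \<Rightarrow> 'l list"
  is "\<lambda>p q M. map (fst \<circ> snd) (filter (\<lambda>m. fst m = p \<and> snd (snd m) = q) M)"
  subgoal for p q M M'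
    by (induction rule: qcong.induct) auto
  done

lemma channel_qempty [simp]: "channel p q qempty = []"
  by transfer simp

lemma channel_qmsg [simp]: "channel p q (qmsg r l s) = (if r = p \<and> s = q then [l] else [])"
  by transfer simp

lemma channel_qapp [simp]: "channel p q (M \<cdot> M') = channel p q M @ channel p q M'"
  by transfer simp

lemma qcong_bring_to_front:
  assumes "\<forall>m\<in>set K. fst m \<noteq> p \<or> snd (snd m) \<noteq> q"
  shows "qcong (K @ (p, l, q) # M) ((p, l, q) # K @ M)"
  using assms
proof (induction K)
  case Nil
  show ?case by (simp add: qcong.refl)
next
  case (Cons m K)
  obtain r k s where m: "m = (r, k, s)" by (cases m)
  have "qcong (m # K @ (p, l, q) # M) (m # (p, l, q) # K @ M)"
    using qcong_append_left[OF Cons.IH, of "[m]"] Cons.prems by simp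
  moreover have "qcong (m # (p, l, q) # K @ M) ((p, l, q) # m # K @ M)"
    using qcong.swap[of r p s q "[]" k l "K @ M"] Cons.prems m by auto
  ultimately show ?case by (auto intro: qcong.trans)
qed

text \<open>The first message of a channel commutes with everything before it in the queue, so it
  can be read at once.\<close>

lemma channel_eq_ConsD:
  assumes "channel p q M = l # ls"
  shows "\<exists>M'. M = qmsg p l q \<cdot> M'"
  using assms
proof (transfer fixing: p q l ls)
  fix M :: "('b \<times> 'a \<times> 'b) list"
  assume "map (fst \<circ> snd) (filter (\<lambda>m. fst m = p \<and> snd (snd m) = q) M) = l # ls"
  then obtain m ms where f: "filter (\<lambda>m. fst m = p \<and> snd (snd m) = q) M = m # ms"
    and l: "fst (snd m) = l"
    by auto
  from f obtain K L where "M = K @ m # L" "\<forall>m\<in>set K. \<not> (fst m = p \<and> snd (snd m) = q)"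
      "fst m = p \<and> snd (snd m) = q"
    by (auto simp: filter_eq_Cons_iff)
  moreover from this l have "m = (p, l, q)" by (cases m) auto
  ultimately show "\<exists>M'. qcong M ([(p, l, q)] @ M')"
    using qcong_bring_to_front[of K p q l L] by auto
qed

section \<open>Local behaviour of players\<close>

inductive local_step :: "('p, 'l) proc \<Rightarrow> ('p, 'l) comm \<Rightarrow> ('p, 'l) proc \<Rightarrow> bool" where
  out: "fmlookup Ps l = Some P \<Longrightarrow> local_step (Send q Ps) (Out p q l) P"
| inp: "fmlookup Ps l = Some P \<Longrightarrow> local_step (Recv p Ps) (In p q l) P"

inductive_cases local_step_SendE: "local_step (Send q Ps) b P"
inductive_cases local_step_RecvE: "local_step (Recv q Ps) b P"

definition outs :: "'p \<Rightarrow> 'p \<Rightarrow> ('p, 'l) comm list \<Rightarrow> 'l list" where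
  "outs p q bs =
     concat (map (\<lambda>b. case b of Out p' q' l \<Rightarrow> if p' = p \<and> q' = q then [l] else [] | _ \<Rightarrow> []) bs)"

definition ins :: "'p \<Rightarrow> 'p \<Rightarrow> ('p, 'l) comm list \<Rightarrow> 'l list" where
  "ins p q bs =
     concat (map (\<lambda>b. case b of In p' q' l \<Rightarrow> if p' = p \<and> q' = q then [l] else [] | _ \<Rightarrow> []) bs)"

lemma outs_simps [simp]:
  "outs p q [] = []"
  "outs p q (Out p' q' l # bs) = (if p' = p \<and> q' = q then l # outs p q bs else outs p q bs)"
  "outs p q (In p' q' l # bs) = outs p q bs"
  "outs p q (bs @ bs') = outs p q bs @ outs p q bs'"
  by (auto simp: outs_def)

lemma ins_simps [simp]:
  "ins p q [] = []"
  "ins p q (In p' q' l # bs) = (if p' = p \<and> q' = q then l # ins p q bs else ins p q bs)"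
  "ins p q (Out p' q' l # bs) = ins p q bs"
  "ins p q (bs @ bs') = ins p q bs @ ins p q bs'"
  by (auto simp: ins_def)

text \<open>Outputs on a channel are moves of its sender, inputs are moves of its receiver
  (\<open>ins_filter_play\<close>); hence the two ends can run on separate clocks.\<close>

lemma outs_filter_play: "outs p q (filter (\<lambda>b. play b = p) bs) = outs p q bs"
proof (induction bs)
  case (Cons b bs) then show ?case by (cases b) auto
qed simp

lemma ins_filter_play: "ins p q (filter (\<lambda>b. play b = q) bs) = ins p q bs"
proof (induction bs)
  case (Cons b bs) then show ?case by (cases b) auto
qed simp

lemma step_local:
  assumes "step S b S'"
  shows "play b = r \<Longrightarrow> local_step (fst S r) b (fst S' r)"
    and "play b \<noteq> r \<Longrightarrow> fst S' r = fst S r"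
  using assms by (auto elim!: step.cases intro: local_step.intros)

text \<open>Outputs append on the right and inputs remove on the left, so both sides spell the same
  stream of labels.\<close>

lemma step_channel:
  assumes "step S b S'"
  shows "channel p q (snd S) @ outs p q [b] = ins p q [b] @ channel p q (snd S')"
  using assms by (auto elim!: step.cases)

lemma steps_append: "steps S bs S' \<Longrightarrow> steps S' bs' S'' \<Longrightarrow> steps S (bs @ bs') S''"
  by (induction rule: steps.induct) (auto intro: steps.intros)

lemma steps_channel:
  "steps S bs S' \<Longrightarrow> channel p q (snd S) @ outs p q bs = ins p q bs @ channel p q (snd S')"
proof (induction rule: steps.induct)
  case (cons S b S' bs S'')
  have "channel p q (snd S) @ outs p q ([b] @ bs) =
      (channel p q (snd S) @ outs p q [b]) @ outs p q bs"
    by (simp only: outs_simps append_assoc)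
  also have "\<dots> = ins p q [b] @ channel p q (snd S') @ outs p q bs"
    by (simp only: step_channel[OF cons.hyps(1)] append_assoc)
  also have "\<dots> = ins p q ([b] @ bs) @ channel p q (snd S'')"
    by (simp only: cons.IH ins_simps append_assoc)
  finally show ?case by simp
qed simp

lemma steps_local_idle:
  "steps S bs S' \<Longrightarrow> filter (\<lambda>b. play b = r) bs = [] \<Longrightarrow> fst S' r = fst S r"
  by (induction rule: steps.induct) (auto simp: step_local(2) split: if_splits)

lemma steps_local_step:
  "steps S bs S' \<Longrightarrow> filter (\<lambda>b. play b = r) bs = [b] \<Longrightarrow> local_step (fst S r) b (fst S' r)"
proof (induction rule: steps.induct)
  case (cons S c S' bs S'')
  show ?case
  proof (cases "play c = r")
    case True
    then have "c = b" "fst S'' r = fst S' r"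
      using cons.prems steps_local_idle[OF cons.hyps(2), of r] by auto
    then show ?thesis using step_local(1)[OF cons.hyps(1) True] by simp
  qed (use cons step_local(2)[OF cons.hyps(1), of r] in auto)
qed simp

lemma step_In_channel:
  assumes "step S (In p q l) S'"
  obtains ls where "channel p q (snd S) = l # ls"
  using step_channel[OF assms, of p q] by simp

section \<open>Lockstep computations\<close>

text \<open>Otherwise \<open>insert b D\<close> would be a larger coherent set.\<close>

lemma max_coherent_player_moves:
  assumes "max_coherent S D" and "step S b S'"
  shows "\<exists>c\<in>D. play c = play b"
proof (rule ccontr)
  assume none: "\<not> ?thesis"
  then have "play b \<notin> play ` D" by force
  moreover have "coherent S D" using assms(1) by (simp add: max_coherent_def)
  ultimately have "coherent S (insert b D)"
    using assms(2) unfolding coherent_def by (auto simp only: inj_on_insert)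
  then have "insert b D = D"
    using assms(1) unfolding max_coherent_def by blast
  then show False using none by blast
qed

locale lockstep_computation =
  fixes n :: enat
    and Ss :: "nat \<Rightarrow> ('p, 'l) session"
    and Ds :: "nat \<Rightarrow> ('p, 'l) comm set"
    and bs :: "nat \<Rightarrow> ('p, 'l) comm list"
  assumes max_coherent: "\<And>i. enat i < n \<Longrightarrow> max_coherent (Ss i) (Ds i)"
    and distinct: "\<And>i. enat i < n \<Longrightarrow> distinct (bs i)"
    and set: "\<And>i. enat i < n \<Longrightarrow> set (bs i) = Ds i"
    and steps: "\<And>i. enat i < n \<Longrightarrow> steps (Ss i) (bs i) (Ss (Suc i))"
    and final: "\<And>k. n = enat k \<Longrightarrow> \<nexists>b S'. step (Ss k) b S'"
begin

definition history :: "nat \<Rightarrow> ('p, 'l) comm list" where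
  "history i = concat (map bs [0..<i])"

lemma history_Suc: "history (Suc i) = history i @ bs i"
  by (simp add: history_def)

lemma history_le: "i \<le> j \<Longrightarrow> \<exists>cs. history j = history i @ cs"
  by (induction rule: dec_induct) (auto simp: history_Suc)

lemma steps_history: "enat i \<le> n \<Longrightarrow> steps (Ss 0) (history i) (Ss i)"
proof (induction i)
  case 0
  show ?case by (simp add: history_def steps.nil)
next
  case (Suc i)
  then have "enat i < n" by (simp add: Suc_ile_eq)
  then show ?case using Suc.IH steps steps_append by (simp add: history_Suc less_imp_le) blast
qed

lemma channel_history:
  "enat i \<le> n \<Longrightarrow>
     channel p q (snd (Ss 0)) @ outs p q (history i) =
     ins p q (history i) @ channel p q (snd (Ss i))"
  using steps_channel[OF steps_history] .

definition moves :: "nat \<Rightarrow> 'p \<Rightarrow> ('p, 'l) comm list" where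
  "moves i r = filter (\<lambda>b. play b = r) (bs i)"

lemma outs_history_Suc: "outs p q (history (Suc i)) = outs p q (history i) @ outs p q (moves i p)"
  by (simp add: history_Suc moves_def outs_filter_play)

lemma ins_history_Suc: "ins p q (history (Suc i)) = ins p q (history i) @ ins p q (moves i q)"
  by (simp add: history_Suc moves_def ins_filter_play)

text \<open>Coherence makes \<open>play\<close> injective on a round, which excludes two moves of
  \<open>r\<close>. It also makes \<open>b\<close> enabled at the start of the round, not only when
  its turn comes in \<open>bs i\<close>.\<close>

lemma moves_cases:
  assumes "enat i < n"
  obtains (idle) "moves i r = []" "fst (Ss (Suc i)) r = fst (Ss i) r"
  | (move) b S' where "moves i r = [b]" "b \<in> Ds i" "play b = r" "step (Ss i) b S'"
      "local_step (fst (Ss i) r) b (fst (Ss (Suc i)) r)"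
proof -
  have inj: "inj_on play (set (bs i))" and enabled: "\<forall>b\<in>set (bs i). \<exists>S'. step (Ss i) b S'"
    using max_coherent[OF assms] set[OF assms] by (auto simp: max_coherent_def coherent_def)
  consider "moves i r = []" | b where "moves i r = [b]" | b c cs where "moves i r = b # c # cs"
    by (metis list.exhaust)
  then show thesis
  proof cases
    case 1
    then show thesis
      using idle steps_local_idle[OF steps[OF assms], of r] by (simp add: moves_def)
  next
    case (2 b)
    then have b: "b \<in> set (bs i)" "play b = r"
      unfolding moves_def by (auto simp: filter_eq_Cons_iff)
    then show thesis
      using move[OF 2] enabled set[OF assms] 2 steps_local_step[OF steps[OF assms], of r b]
      by (auto simp: moves_def)
  next
    case (3 b c cs)
    then have "{b, c} \<subseteq> {x \<in> set (bs i). play x = r}"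
      unfolding moves_def by (metis set_filter insert_subset empty_subsetI list.set_intros)
    moreover have "distinct (moves i r)"
      unfolding moves_def using distinct[OF assms] by (rule distinct_filter)
    ultimately show thesis using inj 3 by (auto dest: inj_onD)
  qed
qed

text \<open>By \<open>final\<close> the computation cannot stop here, and maximality of the round
  makes the player move, possibly with a communication other than \<open>b\<close>.\<close>

lemma enabled_player_moves:
  assumes "enat i \<le> n" and "step (Ss i) b S'"
  shows "enat i < n" and "moves i (play b) \<noteq> []"
proof -
  show lt: "enat i < n" using assms final by (metis order_le_imp_less_or_eq)
  obtain c where "c \<in> Ds i" "play c = play b"
    using max_coherent_player_moves[OF max_coherent[OF lt] assms(2)] by blast
  then show "moves i (play b) \<noteq> []"
    using set[OF lt] by (auto simp: moves_def filter_empty_conv)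
qed

text \<open>The witness \<open>k\<close> is the first round from \<open>i\<close> on in which
  \<open>r\<close> moves; until then its process and its own communications are frozen.\<close>

lemma idle_until_move:
  assumes "i \<le> j" and "enat j \<le> n"
  shows "(\<forall>p. ins p r (history j) = ins p r (history i)) \<and>
         (\<forall>q. outs r q (history j) = outs r q (history i)) \<and>
         fst (Ss j) r = fst (Ss i) r
       \<or> (\<exists>k. i \<le> k \<and> k < j \<and> moves k r \<noteq> [] \<and>
           (\<forall>p. ins p r (history k) = ins p r (history i)) \<and>
           (\<forall>q. outs r q (history k) = outs r q (history i)) \<and>
           fst (Ss k) r = fst (Ss i) r)"
  using assms
proof (induction rule: dec_induct)
  case (step j)
  then have lt: "enat j < n" by (simp add: Suc_ile_eq)
  with step.IH consider (same) "\<forall>p. ins p r (history j) = ins p r (history i)"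
      "\<forall>q. outs r q (history j) = outs r q (history i)" "fst (Ss j) r = fst (Ss i) r"
    | (moved) "\<exists>k. i \<le> k \<and> k < j \<and> moves k r \<noteq> [] \<and>
           (\<forall>p. ins p r (history k) = ins p r (history i)) \<and>
           (\<forall>q. outs r q (history k) = outs r q (history i)) \<and>
           fst (Ss k) r = fst (Ss i) r"
    by (auto simp: less_imp_le)
  then show ?case
  proof cases
    case same
    from lt show ?thesis
    proof (cases rule: moves_cases[where r = r])
      case idle
      then show ?thesis using same by (simp add: ins_history_Suc outs_history_Suc)
    next
      case (move b S')
      then have "moves j r \<noteq> []" by simp
      then show ?thesis using same step.hyps(1) by blast
    qed
  next
    case moved
    then show ?thesis using less_Suc_eq by blast
  qed
qed simp

section \<open>Following a path of the global type\<close>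

text \<open>
  \<open>follows t N M\<close>: the session \<open>(N, M)\<close>, in general not one of the \<open>Ss i\<close>, is obtained if each
  player \<open>r\<close> performs exactly its communications of the first \<open>t r\<close> rounds.
\<close>

definition follows :: "('p \<Rightarrow> nat) \<Rightarrow> ('p, 'l) network \<Rightarrow> ('p, 'l) queue \<Rightarrow> bool" where
  "follows t N M \<longleftrightarrow>
     (\<forall>r. enat (t r) \<le> n \<and> N r = fst (Ss (t r)) r) \<and>
     (\<forall>p q. channel p q (snd (Ss 0)) @ outs p q (history (t p)) =
            ins p q (history (t q)) @ channel p q M)"

lemma follows_init: "Ss 0 = (N, M) \<Longrightarrow> follows (\<lambda>_. 0) N M"
  by (simp add: follows_def history_def zero_enat_def[symmetric])

text \<open>An output waits for nothing, so \<open>p\<close> moves in round \<open>t p\<close>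
  itself. The computation chooses \<open>l\<close>; \<open>l0\<close> witnesses that some output is
  enabled.\<close>

lemma follows_Send:
  assumes inv: "follows t N M" and N: "N p = Send q Ps"
    and nonempty: "fmlookup Ps l0 = Some P0"
  obtains t' l P where "fmlookup Ps l = Some P" "follows t' (N(p := P)) (M \<cdot> qmsg p l q)"
proof -
  let ?i = "t p"
  have le: "enat ?i \<le> n" and Np: "fst (Ss ?i) p = Send q Ps"
    using inv N unfolding follows_def by metis+
  obtain S' where "step (Ss ?i) (Out p q l0) S'"
    using Np nonempty step.out by (metis prod.collapse)
  from enabled_player_moves[OF le this] have lt: "enat ?i < n" and m: "moves ?i p \<noteq> []" by simp_all
  from lt show thesis
  proof (cases rule: moves_cases[where r = p])
    case idle
    then show thesis using m by simp
  next
    case (move b S')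
    from move(5)[unfolded Np] obtain l P where b: "b = Out p q l" and P: "fmlookup Ps l = Some P"
      and P': "fst (Ss (Suc ?i)) p = P"
      using move(3) by (auto elim!: local_step_SendE)
    have "follows (t(p := Suc ?i)) (N(p := P)) (M \<cdot> qmsg p l q)"
      using inv lt P' move(1) unfolding b follows_def
      by (auto simp: Suc_ile_eq outs_history_Suc ins_history_Suc simp flip: append_assoc)
    then show thesis using that P by blast
  qed
qed

text \<open>The receiver may have to wait for the sender, so \<open>h\<close> can be later than
  \<open>t q\<close>; FIFO order fixes the label that it reads.\<close>

lemma follows_Recv:
  assumes inv: "follows t N (qmsg p l q \<cdot> M)" and N: "N q = Recv p Ps"
    and P: "fmlookup Ps l = Some P"
  obtains t' h where "enat h < n" "In p q l \<in> Ds h" "follows t' (N(q := P)) M"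
proof -
  \<comment> \<open>By round \<open>T\<close> both sender and receiver have reached their
    clocks.\<close>
  define T where "T = max (t p) (t q)"
  have le: "enat (t q) \<le> n" "enat (t p) \<le> n" and Nq: "fst (Ss (t q)) q = Recv p Ps"
    using inv N unfolding follows_def by metis+
  then have T: "enat T \<le> n" by (simp add: T_def max_def)
  have chan: "channel p q (snd (Ss 0)) @ outs p q (history (t p)) =
      ins p q (history (t q)) @ l # channel p q M"
    using inv unfolding follows_def by simp
  have head: "\<exists>ls. channel p q (snd (Ss T)) = l # ls"
    if same: "ins p q (history T) = ins p q (history (t q))"
  proof -
    obtain cs where "history T = history (t p) @ cs"
      using history_le[of "t p" T] by (auto simp: T_def)
    then have "ins p q (history T) @ channel p q (snd (Ss T)) =
        (channel p q (snd (Ss 0)) @ outs p q (history (t p))) @ outs p q cs"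
      using channel_history[OF T, of p q] by simp
    then show ?thesis unfolding chan same by simp
  qed
  \<comment> \<open>If \<open>q\<close> idles up to \<open>T\<close>, then \<open>head\<close>
    enables its input there, so it moves in round \<open>T\<close> at the latest.\<close>
  have "\<exists>k. t q \<le> k \<and> k \<le> T \<and> enat k < n \<and> moves k q \<noteq> [] \<and>
      (\<forall>a. ins a q (history k) = ins a q (history (t q))) \<and>
      (\<forall>b. outs q b (history k) = outs q b (history (t q))) \<and> fst (Ss k) q = fst (Ss (t q)) q"
    using idle_until_move[of "t q" T q, OF max.cobounded2[of "t q" "t p", folded T_def] T]
  proof (elim disjE)
    assume same: "(\<forall>a. ins a q (history T) = ins a q (history (t q))) \<and>
      (\<forall>b. outs q b (history T) = outs q b (history (t q))) \<and> fst (Ss T) q = fst (Ss (t q)) q"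
    then obtain ls where "channel p q (snd (Ss T)) = l # ls" using head by blast
    then obtain M' where "snd (Ss T) = qmsg p l q \<cdot> M'" by (auto dest: channel_eq_ConsD)
    then have "step (Ss T) (In p q l) ((fst (Ss T))(q := P), M')"
      using step.inp[of "fst (Ss T)" q p Ps l P M'] same Nq P by (metis prod.collapse)
    from enabled_player_moves[OF T this] same show ?thesis
      by (intro exI[of _ T]) (simp add: T_def)
  next
    assume "\<exists>k\<ge>t q. k < T \<and> moves k q \<noteq> [] \<and>
      (\<forall>a. ins a q (history k) = ins a q (history (t q))) \<and>
      (\<forall>b. outs q b (history k) = outs q b (history (t q))) \<and> fst (Ss k) q = fst (Ss (t q)) q"
    then show ?thesis
      using T by (meson enat_ord_simps(2) less_imp_le order_less_le_trans)
  qed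
  then obtain k where k: "t q \<le> k" "k \<le> T" "enat k < n" "moves k q \<noteq> []"
      "\<forall>a. ins a q (history k) = ins a q (history (t q))"
      "\<forall>b. outs q b (history k) = outs q b (history (t q))"
      "fst (Ss k) q = fst (Ss (t q)) q"
    by blast
  from k(3) show thesis
  proof (cases rule: moves_cases[where r = q])
    case idle
    then show thesis using k(4) by simp
  next
    case (move b S')
    from move(5)[unfolded k(7) Nq] obtain l' P' where b: "b = In p q l'"
      and P': "fmlookup Ps l' = Some P'" "fst (Ss (Suc k)) q = P'"
      using move(3) by (auto elim!: local_step_RecvE)
    obtain ls where ls: "channel p q (snd (Ss k)) = l' # ls"
      using move(4) unfolding b by (rule step_In_channel)
    have now: "channel p q (snd (Ss 0)) @ outs p q (history k) = ins p q (history (t q)) @ l' # ls"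
      using channel_history[of k p q] k(3,5) ls by (simp add: less_imp_le)
    \<comment> \<open>Of \<open>history k\<close> and \<open>history (t p)\<close> one extends the
      other, hence so do the streams in \<open>now\<close> and \<open>chan\<close>;
      \<open>l'\<close> and \<open>l\<close> sit there at the same position, right after
      \<open>ins p q (history (t q))\<close>.\<close>
    have "l' = l"
    proof (cases "t p \<le> k")
      case True
      then obtain cs where "history k = history (t p) @ cs" using history_le by blast
      then have "(channel p q (snd (Ss 0)) @ outs p q (history (t p))) @ outs p q cs =
          ins p q (history (t q)) @ l' # ls"
        using now by simp
      then show ?thesis unfolding chan by simp
    next
      case False
      then obtain cs where "history (t p) = history k @ cs" using history_le[of k "t p"] by auto
      then have "(channel p q (snd (Ss 0)) @ outs p q (history k)) @ outs p q cs =
          ins p q (history (t q)) @ l # channel p q M"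
        using chan by simp
      then show ?thesis unfolding now by simp
    qed
    then have *: "moves k q = [In p q l]" "fst (Ss (Suc k)) q = P" "In p q l \<in> Ds k"
      using move P P' b by auto
    \<comment> \<open>The rounds from \<open>t q\<close> to before \<open>k\<close> add no
      communication of \<open>q\<close>, so its clock can jump to \<open>Suc k\<close>.\<close>
    have "follows (t(q := Suc k)) (N(q := P)) M"
      using inv k * unfolding follows_def
      by (auto simp: Suc_ile_eq outs_history_Suc ins_history_Suc)
    then show thesis using that k(3) *(3) by blast
  qed
qed

text \<open>\<open>R\<close> is the part of the initial queue not yet read on the path; the path's
  queue \<open>M\<close> extends it in each channel by messages sent on the way. Induction on
  \<open>readable\<close>, along the branches chosen by the computation, keeps \<open>l\<close>
  first in its channel of \<open>R\<close> until it is read; the \<open>empty\<close> case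
  contradicts its presence.\<close>

lemma readable_message_is_read:
  assumes wf: "wf_gtype G0"
  assumes "readable G R" and "G \<in> subgtypes G0" and "typed G N" and "balanced G M"
    and "follows t N M"
    and "\<And>a b. prefix (channel a b R) (channel a b M)" and "channel p q R = l # ls"
  shows "\<exists>h. enat h < n \<and> In p q l \<in> Ds h"
  using assms(2-)
proof (induction arbitrary: N M t ls rule: readable.induct)
  case (empty G)
  then show ?case by simp
next
  case (out Gs R a b)
  from out.prems(2) obtain N0 Ps where N: "N = N0(a := Send b Ps)" and dom: "fmdom Gs = fmdom Ps"
    and typed: "\<forall>l G P. fmlookup Gs l = Some G \<and> fmlookup Ps l = Some P \<longrightarrow> typed G (N0(a := P))"
    by cases blast
  have bal: "\<forall>l G. fmlookup Gs l = Some G \<longrightarrow> balanced G (M \<cdot> qmsg a l b)"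
    using out.prems(3) by cases auto
  \<comment> \<open>Well-formedness of \<open>G0\<close> covers every node of the path, so the
    sender has a branch.\<close>
  have "Ps \<noteq> fmempty"
    using out.prems(1) wf dom unfolding wf_gtype_def by (metis fmdom_empty fmrestrict_fset_dom fmrestrict_fset_null)
  then obtain l0 P0 where "fmlookup Ps l0 = Some P0"
    by (metis fmap_ext fmempty_lookup option.exhaust)
  then obtain t' k P where P: "fmlookup Ps k = Some P"
    and inv: "follows t' (N(a := P)) (M \<cdot> qmsg a k b)"
    using follows_Send[OF out.prems(4), of a b Ps l0 P0] N by (metis fun_upd_same)
  obtain G where G: "fmlookup Gs k = Some G"
    using P dom by (metis fmdomE fmdomI)
  show ?case
  proof (rule out.IH[rule_format, OF G, THEN conjunct2, rule_format])
    show "G \<in> subgtypes G0" using out.prems(1) G by (rule subgtypes.out)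
    show "typed G (N(a := P))" using typed G P N by simp
    show "balanced G (M \<cdot> qmsg a k b)" using bal G by blast
    show "prefix (channel c d R) (channel c d (M \<cdot> qmsg a k b))" for c d
      using out.prems(5)[of c d] by simp
  qed (use inv out.prems(6) in auto)
next
  case (inp_read k Gs R a b)
  from inp_read.prems(2) obtain N0 Ps where N: "N = N0(b := Recv a Ps)"
    and dom: "fmdom Gs |\<subseteq>| fmdom Ps"
    and typed: "\<forall>l G P. fmlookup Gs l = Some G \<and> fmlookup Ps l = Some P \<longrightarrow> typed G (N0(b := P))"
    by cases blast
  from inp_read.prems(3) obtain h G M1 where M: "M = qmsg a h b \<cdot> M1"
    and G: "fmlookup Gs h = Some G" and bal: "balanced G M1"
    by cases blast
  \<comment> \<open>\<open>k\<close> heads the channel from \<open>a\<close> to \<open>b\<close> in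
    the unread part, a prefix of the channel headed by \<open>h\<close>.\<close>
  have "k = h" using inp_read.prems(5)[of a b] M by simp
  obtain P where P: "fmlookup Ps h = Some P"
    using G dom by (meson fmdomE fmdomI fsubsetD)
  obtain t' i where i: "enat i < n" "In a b h \<in> Ds i" and inv: "follows t' (N(b := P)) M1"
    using follows_Recv[OF inp_read.prems(4)[unfolded M], of Ps P] N P by (metis fun_upd_same)
  show ?case
  proof (cases "a = p \<and> b = q")
    case True
    then show ?thesis using i \<open>k = h\<close> inp_read.prems(6) by auto
  next
    case False
    show ?thesis
    proof (rule inp_read.IH[rule_format, OF G, THEN conjunct2, rule_format])
      show "G \<in> subgtypes G0" using inp_read.prems(1) G by (rule subgtypes.inp)
      show "typed G (N(b := P))" using typed G P N by simp
      show "prefix (channel c d R) (channel c d M1)" for c d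
        using inp_read.prems(5)[of c d] M \<open>k = h\<close> by (simp split: if_splits)
    qed (use inv bal False inp_read.prems(6) in auto)
  qed
next
  case (inp_skip Gs R a b)
  from inp_skip.prems(2) obtain N0 Ps where N: "N = N0(b := Recv a Ps)"
    and dom: "fmdom Gs |\<subseteq>| fmdom Ps"
    and typed: "\<forall>l G P. fmlookup Gs l = Some G \<and> fmlookup Ps l = Some P \<longrightarrow> typed G (N0(b := P))"
    by cases blast
  from inp_skip.prems(3) obtain h G M1 where M: "M = qmsg a h b \<cdot> M1"
    and G: "fmlookup Gs h = Some G" and bal: "balanced G M1"
    by cases blast
  \<comment> \<open>If nonempty, this channel of \<open>R\<close> would start with \<open>h\<close>,
    a label of \<open>Gs\<close>, which the skip rule forbids. So the message read lies outside
    \<open>R\<close>, which stays a channelwise prefix.\<close>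
  have none: "channel a b R = []"
  proof (rule ccontr)
    assume "channel a b R \<noteq> []"
    then obtain ms where "channel a b R = h # ms"
      using inp_skip.prems(5)[of a b] M by (cases "channel a b R") auto
    then show False using channel_eq_ConsD inp_skip.hyps(1) G fmdomI by metis
  qed
  obtain P where P: "fmlookup Ps h = Some P"
    using G dom by (meson fmdomE fmdomI fsubsetD)
  obtain t' where inv: "follows t' (N(b := P)) M1"
    using follows_Recv[OF inp_skip.prems(4)[unfolded M], of Ps P] N P by (metis fun_upd_same)
  show ?case
  proof (rule inp_skip.IH[rule_format, OF G, THEN conjunct2, rule_format])
    show "G \<in> subgtypes G0" using inp_skip.prems(1) G by (rule subgtypes.inp)
    show "typed G (N(b := P))" using typed G P N by simp
    show "prefix (channel c d R) (channel c d M1)" for c d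
      using inp_skip.prems(5)[of c d] M none by (cases "a = c \<and> b = d") auto
  qed (use inv bal inp_skip.prems(6) in auto)
qed

end

lemma balanced_imp_readable: "balanced G M \<Longrightarrow> readable G M"
  by (erule balanced.cases) (auto intro: readable.empty)

theorem theorem4p19:
  fixes G :: "('p, 'l) gtype" and N :: "('p, 'l) network" and M :: "('p, 'l) queue"
  assumes "wf_gtype G"
    and "wf_network N"
    and "typed G N"
    and "bounded_gtype G"
    and "balanced G M"
  shows "queue_consuming N M"
  unfolding queue_consuming_def
proof (intro allI impI)
  fix p l q M' n Ss Ds
  assume M: "M = qmsg p l q \<cdot> M'" and complete: "complete_lockstep (N, M) n Ss Ds"
  have "\<forall>i. \<exists>bs. enat i < n \<longrightarrow> distinct bs \<and> set bs = Ds i \<and> steps (Ss i) bs (Ss (Suc i))"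
    using complete unfolding complete_lockstep_def lockstep_def by blast
  then obtain bs where bs: "\<And>i. enat i < n \<Longrightarrow>
      distinct (bs i) \<and> set (bs i) = Ds i \<and> steps (Ss i) (bs i) (Ss (Suc i))"
    by metis
  interpret lockstep_computation n Ss Ds bs
  proof
    show "max_coherent (Ss i) (Ds i)" if "enat i < n" for i
      using complete that unfolding complete_lockstep_def lockstep_def by blast
    show "\<nexists>b S'. step (Ss k) b S'" if "n = enat k" for k
      using complete that unfolding complete_lockstep_def by blast
  qed (use bs in blast)+
  have "follows (\<lambda>_. 0) N M"
    using complete by (intro follows_init) (simp add: complete_lockstep_def)
  \<comment> \<open>At the start nothing has been read, so \<open>R\<close> is \<open>M\<close>
    itself.\<close>
  then show "\<exists>h. enat h < n \<and> In p q l \<in> Ds h"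
    using readable_message_is_read[OF assms(1) balanced_imp_readable[OF assms(5)] subgtypes.self
        assms(3,5), of "\<lambda>_. 0" p q l "channel p q M'"]
    by (simp add: M)
qed

end
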